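(* Let $X,Y$ be nonempty sets, let $c:X\times Y\to\mathbb{R}$ be any function, and let $C:(X\times Y)\times(Y\times X)\to\mathbb{R}$ be defined by $C((x,y),(t,s))=c(x,t)+c(s,y)$. Let $T:X\rightrightarrows Y$ be a multivalued mapping with $G(T)\neq\emptyset$. (A) The following assertions are equivalent: 1. $T$ is $c$-monotone; 2. $\Delta_T$ is $C$-monotone; 3. $\Delta_T$ is $C$-cyclically monotone; 4. $G(\Delta_T)\subset G(\partial_C(c+\iota_{G(T)}))$, that is, $c+\iota_{G(T)}$ is a $C$-antiderivative of $\Delta_T$. Consequently, the following assertions are equivalent: 1$'$. $T$ is maximal $c$-monotone; 2$'$. $\Delta_T$ is maximal $C$-monotone in $\Delta$; 3$'$. $\Delta_T$ is maximal $C$-cyclically monotone in $\Delta$; 4$'$. $G(T)$ is a maximal subset of $X\times Y$ (with respect to inclusion) such that $G(\Delta_T)\subset G(\partial_C(c+\iota_{G(T)}))$. (B) If $T$ is $c$-monotone, then $$\alpha_{[C,c|_{G(T)},\Delta_T]}=F_{[c,T]}.$$ If $T$ is maximal $c$-monotone, then $$\mathcal{A}_{[C,c|_{G(T)},\Delta_T]}\subset\mathcal{F}_{[c,T]}.$$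
   Context: General notions for nonempty sets $U,V$ and a function $b:U\times V\to\mathbb{R}$ (used with $(U,V,b)=(X,Y,c)$ and with $(U,V,b)=(X\times Y,\,Y\times X,\,C)$): A function $f:U\to(-\infty,+\infty]$ is proper if it is finite somewhere. A proper $f:U\to(-\infty,+\infty]$ is $b$-convex if there is $g:V\to(-\infty,+\infty]$ with $f(u)=\sup_{v\in V}[b(u,v)-g(v)]$ for all $u$; $\Gamma_b(U)$ is the set of $b$-convex functions on $U$. For proper $f$, $\partial_b f(u)=\{v\in V: f(u)+b(u',v)\le f(u')+b(u,v)\ \forall u'\in U\}$. The graph of $M:U\rightrightarrows V$ is $G(M)=\{(u,v): v\in M(u)\}$; a proper $f$ is a $b$-antiderivative of $M$ if $G(M)\subset G(\partial_b f)$. $M$ is $n$-$b$-monotone if for all $(u_1,v_1),\dots,(u_n,v_n)\in G(M)$, with $u_{n+1}=u_1$, $0\le\sum_{i=1}^n[b(u_i,v_i)-b(u_{i+1},v_i)]$; $b$-monotone means $2$-$b$-monotone; $b$-cyclically monotone means $n$-$b$-monotone for all $n\in\mathbb{N}$. $M$ is maximal $b$-monotone if $G(M)$ is $b$-monotone and has no proper $b$-monotone extension in $U\times V$. $\Delta=\{((x,y),(y,x)):(x,y)\in X\times Y\}\subset(X\times Y)\times(Y\times X)$, and $\Delta_T:X\times Y\rightrightarrows Y\times X$ is the mapping with graph $G(\Delta_T)=\{((x,y),(y,x)):(x,y)\in G(T)\}$. "Maximal $C$-monotone (resp. $C$-cyclically monotone) in $\Delta$" means that $G(\Delta_T)$ is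 $C$-monotone (resp. $C$-cyclically monotone) and no strictly larger subset of $\Delta$ is. $\iota_{A}$ is the indicator function of $A$: $0$ on $A$ and $+\infty$ off $A$. $\mathcal{A}_{[C,c|_{G(T)},\Delta_T]}$ is the set of all $C$-convex functions $h:X\times Y\to(-\infty,+\infty]$ such that $G(\Delta_T)\subset G(\partial_C h)$ and $h|_{G(T)}=c|_{G(T)}$; $\alpha_{[C,c|_{G(T)},\Delta_T]}$ is the pointwise infimum of all functions in this set. The Fitzpatrick function is $F_{[c,T]}(x,y)=\sup_{(s,t)\in G(T)}[c(x,t)+c(s,y)-c(s,t)]$, $(x,y)\in X\times Y$. The Fitzpatrick family is $\mathcal{F}_{[c,T]}=\{f\in\Gamma_C(X\times Y): c\le f,\ f|_{G(T)}=c|_{G(T)}\}$. *)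

theory Defs
  imports "HOL-Library.Extended_Real"
begin

text \<open>
  Nonempty sets are rendered as types, which are always inhabited. A function with values in
  the half-open line (from minus infinity, excluded, up to and including plus infinity) is an
  \<open>ereal\<close>-valued function that never takes the value \<open>-\<infinity>\<close>; a multivalued mapping from
  \<open>U\<close> to \<open>V\<close> is a function \<open>'u \<Rightarrow> 'v set\<close>.
\<close>

definition no_minf :: "('u \<Rightarrow> ereal) \<Rightarrow> bool" where
  "no_minf f \<longleftrightarrow> (\<forall>u. f u \<noteq> -\<infinity>)"

definition proper_fun :: "('u \<Rightarrow> ereal) \<Rightarrow> bool" where
  "proper_fun f \<longleftrightarrow> no_minf f \<and> (\<exists>u. f u \<noteq> \<infinity>)"

definition b_convex :: "('u \<times> 'v \<Rightarrow> real) \<Rightarrow> ('u \<Rightarrow> ereal) \<Rightarrow> bool" where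
  "b_convex b f \<longleftrightarrow> proper_fun f \<and>
     (\<exists>g :: 'v \<Rightarrow> ereal. no_minf g \<and> (\<forall>u. f u = (SUP v. ereal (b (u, v)) - g v)))"

definition Gamma_conv :: "('u \<times> 'v \<Rightarrow> real) \<Rightarrow> ('u \<Rightarrow> ereal) set" where
  "Gamma_conv b = {f. b_convex b f}"

definition subdiff :: "('u \<times> 'v \<Rightarrow> real) \<Rightarrow> ('u \<Rightarrow> ereal) \<Rightarrow> 'u \<Rightarrow> 'v set" where
  "subdiff b f u =
     {v. \<forall>u'. f u + ereal (b (u', v)) \<le> f u' + ereal (b (u, v))}"

definition mgraph :: "('u \<Rightarrow> 'v set) \<Rightarrow> ('u \<times> 'v) set" where
  "mgraph M = {(u, v). v \<in> M u}"

definition map_of_graph :: "('u \<times> 'v) set \<Rightarrow> 'u \<Rightarrow> 'v set" where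
  "map_of_graph A = (\<lambda>u. {v. (u, v) \<in> A})"

definition antiderivative ::
    "('u \<times> 'v \<Rightarrow> real) \<Rightarrow> ('u \<Rightarrow> 'v set) \<Rightarrow> ('u \<Rightarrow> ereal) \<Rightarrow> bool" where
  "antiderivative b M f \<longleftrightarrow> proper_fun f \<and> mgraph M \<subseteq> mgraph (subdiff b f)"

definition n_b_monotone :: "nat \<Rightarrow> ('u \<times> 'v \<Rightarrow> real) \<Rightarrow> ('u \<Rightarrow> 'v set) \<Rightarrow> bool" where
  "n_b_monotone n b M \<longleftrightarrow>
     (\<forall>(u :: nat \<Rightarrow> 'u) (v :: nat \<Rightarrow> 'v).
        (\<forall>i\<in>{1..n}. (u i, v i) \<in> mgraph M) \<and> u (n + 1) = u 1 \<longrightarrow>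
        0 \<le> (\<Sum>i = 1..n. b (u i, v i) - b (u (i + 1), v i)))"

definition b_monotone :: "('u \<times> 'v \<Rightarrow> real) \<Rightarrow> ('u \<Rightarrow> 'v set) \<Rightarrow> bool" where
  "b_monotone b M \<longleftrightarrow> n_b_monotone 2 b M"

definition b_cyclically_monotone :: "('u \<times> 'v \<Rightarrow> real) \<Rightarrow> ('u \<Rightarrow> 'v set) \<Rightarrow> bool" where
  "b_cyclically_monotone b M \<longleftrightarrow> (\<forall>n. n_b_monotone n b M)"

text \<open>\<open>M\<close> has the property \<open>P\<close>, and no mapping whose graph is strictly larger and still
  contained in \<open>D\<close> has it.\<close>

definition maximal_in ::
    "(('u \<Rightarrow> 'v set) \<Rightarrow> bool) \<Rightarrow> ('u \<times> 'v) set \<Rightarrow> ('u \<Rightarrow> 'v set) \<Rightarrow> bool" where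
  "maximal_in P D M \<longleftrightarrow> P M \<and> mgraph M \<subseteq> D \<and>
     (\<forall>N. mgraph M \<subset> mgraph N \<and> mgraph N \<subseteq> D \<longrightarrow> \<not> P N)"

definition maximal_b_monotone :: "('u \<times> 'v \<Rightarrow> real) \<Rightarrow> ('u \<Rightarrow> 'v set) \<Rightarrow> bool" where
  "maximal_b_monotone b M \<longleftrightarrow> maximal_in (b_monotone b) UNIV M"

definition iota :: "'u set \<Rightarrow> 'u \<Rightarrow> ereal" where
  "iota A u = (if u \<in> A then 0 else \<infinity>)"

definition big_C :: "('x \<times> 'y \<Rightarrow> real) \<Rightarrow> ('x \<times> 'y) \<times> ('y \<times> 'x) \<Rightarrow> real" where
  "big_C c = (\<lambda>((x, y), (t, s)). c (x, t) + c (s, y))"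

definition Delta :: "(('x \<times> 'y) \<times> ('y \<times> 'x)) set" where
  "Delta = {((x, y), (y, x)) | x y. True}"

definition Delta_map :: "('x \<Rightarrow> 'y set) \<Rightarrow> 'x \<times> 'y \<Rightarrow> ('y \<times> 'x) set" where
  "Delta_map T = map_of_graph {((x, y), (y, x)) | x y. (x, y) \<in> mgraph T}"

definition c_plus_iota :: "('x \<times> 'y \<Rightarrow> real) \<Rightarrow> ('x \<Rightarrow> 'y set) \<Rightarrow> 'x \<times> 'y \<Rightarrow> ereal" where
  "c_plus_iota c T = (\<lambda>z. ereal (c z) + iota (mgraph T) z)"

text \<open>In the next two definitions the pair \<open>\<phi>\<close>, \<open>S\<close> encodes the restricted function
  \<open>\<phi>\<close> on \<open>S\<close>: only the values of \<open>\<phi>\<close> on \<open>S\<close> matter.\<close>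

definition antideriv_family ::
    "('u \<times> 'v \<Rightarrow> real) \<Rightarrow> ('u \<Rightarrow> real) \<Rightarrow> 'u set \<Rightarrow> ('u \<Rightarrow> 'v set) \<Rightarrow> ('u \<Rightarrow> ereal) set" where
  "antideriv_family b \<phi> S M =
     {h. b_convex b h \<and> mgraph M \<subseteq> mgraph (subdiff b h) \<and> (\<forall>u\<in>S. h u = ereal (\<phi> u))}"

definition minimal_antideriv ::
    "('u \<times> 'v \<Rightarrow> real) \<Rightarrow> ('u \<Rightarrow> real) \<Rightarrow> 'u set \<Rightarrow> ('u \<Rightarrow> 'v set) \<Rightarrow> 'u \<Rightarrow> ereal" where
  "minimal_antideriv b \<phi> S M = (\<lambda>u. INF h \<in> antideriv_family b \<phi> S M. h u)"

definition Fitzpatrick :: "('x \<times> 'y \<Rightarrow> real) \<Rightarrow> ('x \<Rightarrow> 'y set) \<Rightarrow> 'x \<times> 'y \<Rightarrow> ereal" where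
  "Fitzpatrick c T =
     (\<lambda>(x, y). SUP (s, t) \<in> mgraph T. ereal (c (x, t) + c (s, y) - c (s, t)))"

definition Fitzpatrick_family ::
    "('x \<times> 'y \<Rightarrow> real) \<Rightarrow> ('x \<Rightarrow> 'y set) \<Rightarrow> ('x \<times> 'y \<Rightarrow> ereal) set" where
  "Fitzpatrick_family c T =
     {f \<in> Gamma_conv (big_C c). (\<forall>z. ereal (c z) \<le> f z) \<and> (\<forall>z\<in>mgraph T. f z = ereal (c z))}"

end

theory Submission
  imports Defs
begin

text \<open>
  Everything rests on one symmetric quantity, the gap
  \<open>q(z, w) = c(x, y) + c(s, t) - c(x, t) - c(s, y)\<close> of two points \<open>z = (x, y)\<close> and
  \<open>w = (s, t)\<close>. By definition \<open>T\<close> is \<open>c\<close>-monotone iff \<open>q \<ge> 0\<close> on the graph of \<open>T\<close>.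
  On the antidiagonal the coupling \<open>C\<close> satisfies \<open>C(z, z\<^sup>T) = 2 c(z)\<close> and
  \<open>C(z, w\<^sup>T) = C(w, z\<^sup>T) = c(z) + c(w) - q(z, w)\<close>, where \<open>z\<^sup>T\<close> swaps the components of \<open>z\<close>.
  Hence the summand \<open>C(z, z\<^sup>T) - C(w, z\<^sup>T)\<close> in a cyclic sum equals \<open>q(z, w) + c(z) - c(w)\<close>.
  The differences of \<open>c\<close> telescope around the cycle, and what remains is a sum of gaps of
  consecutive points. This is why two-point monotonicity already forces cyclic monotonicity of
  \<open>\<Delta>\<^sub>T\<close>, a phenomenon that fails for general couplings. The subgradient inequality for
  \<open>c + \<iota>\<close> at \<open>z\<close>, tested at a graph point \<open>w\<close>, is again \<open>q(z, w) \<ge> 0\<close>.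

  Maximality transfers for a formal reason: \<open>T \<mapsto> \<Delta>\<^sub>T\<close> is an isomorphism, for inclusion of
  graphs, from mappings \<open>X \<rightrightarrows> Y\<close> onto those mappings whose graph lies in \<open>\<Delta>\<close>
  (\<open>maximal_in_Delta\<close>).

  For the minimal antiderivative, note that \<open>F(u) = sup {C(u, z\<^sup>T) - c(z) | z \<in> G(T)}\<close>. A
  function equal to \<open>c\<close> on \<open>G(T)\<close> has every \<open>z\<^sup>T\<close> as a \<open>C\<close>-subgradient at \<open>z\<close> exactly when
  it dominates each of the functions \<open>C(\<cdot>, z\<^sup>T) - c(z)\<close>, that is, when it dominates \<open>F\<close>. If \<open>T\<close>
  is \<open>c\<close>-monotone then \<open>F\<close> itself belongs to the family, so it is the least element and not
  merely a lower bound. If \<open>T\<close> is maximal, a point outside \<open>G(T)\<close> has negative gap with some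
  graph point, which says that \<open>F > c\<close> there; thus \<open>c \<le> F\<close> everywhere, and all antiderivatives
  in the family inherit this bound.
\<close>

section \<open>The gap of two points\<close>

definition gap :: "('x \<times> 'y \<Rightarrow> real) \<Rightarrow> 'x \<times> 'y \<Rightarrow> 'x \<times> 'y \<Rightarrow> real" where
  "gap c z w = c z + c w - c (fst z, snd w) - c (fst w, snd z)"

lemma gap_self [simp]: "gap c z z = 0"
  by (simp add: gap_def)

lemma gap_commute: "gap c z w = gap c w z"
  by (simp add: gap_def)

lemma big_C_swap: "big_C c (w, prod.swap z) = c w + c z - gap c z w"
  by (cases z; cases w) (simp add: big_C_def gap_def)

lemma mgraph_Delta_map: "mgraph (Delta_map T) = (\<lambda>z. (z, prod.swap z)) ` mgraph T"
  by (auto simp: mgraph_def Delta_map_def map_of_graph_def image_iff)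

lemma n_b_monotone_2_iff:
  "n_b_monotone 2 b M \<longleftrightarrow>
     (\<forall>(u, v) \<in> mgraph M. \<forall>(u', v') \<in> mgraph M. b (u', v) + b (u, v') \<le> b (u, v) + b (u', v'))"
  (is "?L \<longleftrightarrow> ?R")
proof
  assume L: ?L
  have "b (u', v) + b (u, v') \<le> b (u, v) + b (u', v')"
    if "(u, v) \<in> mgraph M" "(u', v') \<in> mgraph M" for u v u' v'
  proof -
    \<comment> \<open>The first point occupies every position but 2, so position 3 returns to position 1.\<close>
    have "0 \<le> (\<Sum>i = 1..2::nat. b (if i = 2 then u' else u, if i = 2 then v' else v)
                - b (if i + 1 = 2 then u' else u, if i = 2 then v' else v))"
      using L[unfolded n_b_monotone_def, rule_format,
          of "\<lambda>i::nat. if i = 2 then u' else u" "\<lambda>i. if i = 2 then v' else v"] that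
      by simp
    then show ?thesis
      by (simp add: numeral_2_eq_2)
  qed
  then show ?R by blast
next
  assume R: ?R
  show ?L
    unfolding n_b_monotone_def
  proof (intro allI impI, elim conjE)
    fix u :: "nat \<Rightarrow> 'a" and v :: "nat \<Rightarrow> 'b"
    assume "\<forall>i\<in>{1..2}. (u i, v i) \<in> mgraph M" and cyc: "u (2 + 1) = u 1"
    then have "(u 1, v 1) \<in> mgraph M" "(u 2, v 2) \<in> mgraph M" by auto
    then have "b (u 2, v 1) + b (u 1, v 2) \<le> b (u 1, v 1) + b (u 2, v 2)"
      using R by blast
    then show "0 \<le> (\<Sum>i = 1..2. b (u i, v i) - b (u (i + 1), v i))"
      using cyc by (simp add: numeral_2_eq_2 numeral_3_eq_3)
  qed
qed

section \<open>Monotonicity, cyclic monotonicity and subgradients\<close>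

lemma b_monotone_iff_gap:
  "b_monotone c T \<longleftrightarrow> (\<forall>z \<in> mgraph T. \<forall>w \<in> mgraph T. 0 \<le> gap c z w)"
  unfolding b_monotone_def n_b_monotone_2_iff gap_def by (fastforce simp: algebra_simps)

text \<open>On \<open>\<Delta>\<close> both mixed terms of \<open>C\<close> coincide, so the two-point sum for \<open>C\<close> is exactly twice
  the gap.\<close>

lemma b_monotone_Delta_map_iff: "b_monotone (big_C c) (Delta_map T) \<longleftrightarrow> b_monotone c T"
proof -
  have "big_C c (w, prod.swap z) + big_C c (z, prod.swap w)
          \<le> big_C c (z, prod.swap z) + big_C c (w, prod.swap w) \<longleftrightarrow> 0 \<le> gap c z w" for z w
    by (simp add: big_C_swap gap_commute[of c w z])
  then show ?thesis
    unfolding b_monotone_iff_gap[of c T]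
    unfolding b_monotone_def n_b_monotone_2_iff mgraph_Delta_map
    by simp
qed

text \<open>Each summand on the left is the gap plus \<open>c(u\<^sub>i) - c(u\<^sub>i\<^sub>+\<^sub>1)\<close>, and these differences
  telescope to zero around the cycle.\<close>

lemma cyclic_sum_big_C:
  fixes u :: "nat \<Rightarrow> 'x \<times> 'y"
  assumes "u (n + 1) = u 1"
  shows "(\<Sum>i = 1..n. big_C c (u i, prod.swap (u i)) - big_C c (u (i + 1), prod.swap (u i)))
           = (\<Sum>i = 1..n. gap c (u i) (u (i + 1)))"
proof -
  have "(\<Sum>i = 1..n. big_C c (u i, prod.swap (u i)) - big_C c (u (i + 1), prod.swap (u i)))
          = (\<Sum>i = 1..n. gap c (u i) (u (i + 1))) - (\<Sum>i = 1..n. c (u (Suc i)) - c (u i))"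
    by (simp add: big_C_swap flip: sum_subtractf) (simp add: algebra_simps)
  also have "(\<Sum>i = 1..n. c (u (Suc i)) - c (u i)) = 0"
    using assms by (subst sum_Suc_diff) auto
  finally show ?thesis by simp
qed

lemma cyclically_monotone_Delta_map_iff:
  "b_cyclically_monotone (big_C c) (Delta_map T) \<longleftrightarrow> b_monotone c T"
proof
  assume "b_cyclically_monotone (big_C c) (Delta_map T)"
  then have "b_monotone (big_C c) (Delta_map T)"
    by (simp add: b_cyclically_monotone_def b_monotone_def)
  then show "b_monotone c T"
    by (simp add: b_monotone_Delta_map_iff)
next
  assume mono: "b_monotone c T"
  show "b_cyclically_monotone (big_C c) (Delta_map T)"
    unfolding b_cyclically_monotone_def n_b_monotone_def
  proof (intro allI impI, elim conjE)
    fix n and u :: "nat \<Rightarrow> 'a \<times> 'b" and v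
    assume uv: "\<forall>i\<in>{1..n}. (u i, v i) \<in> mgraph (Delta_map T)" and cyc: "u (n + 1) = u 1"
    have graph: "u i \<in> mgraph T" and v: "v i = prod.swap (u i)" if "i \<in> {1..n}" for i
      using bspec[OF uv that] by (auto simp: mgraph_Delta_map)
    have "u (i + 1) \<in> mgraph T" if "i \<in> {1..n}" for i
      using graph[of "i + 1"] graph[of 1] cyc that by (cases "i = n") auto
    then have "0 \<le> (\<Sum>i = 1..n. gap c (u i) (u (i + 1)))"
      using mono graph unfolding b_monotone_iff_gap by (intro sum_nonneg) blast
    then show "0 \<le> (\<Sum>i = 1..n. big_C c (u i, v i) - big_C c (u (i + 1), v i))"
      using cyclic_sum_big_C[OF cyc, of c] v by simp
  qed
qed

lemma Delta_map_subdiff_iff: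
  "mgraph (Delta_map T) \<subseteq> mgraph (subdiff (big_C c) h) \<longleftrightarrow>
     (\<forall>z \<in> mgraph T. \<forall>u. h z + ereal (big_C c (u, prod.swap z)) \<le> h u + ereal (2 * c z))"
  unfolding mgraph_Delta_map image_subset_iff
  by (simp add: mgraph_def[of "subdiff _ _"] subdiff_def big_C_swap)

lemma Delta_map_subdiff_c_plus_iota_iff:
  "mgraph (Delta_map T) \<subseteq> mgraph (subdiff (big_C c) (c_plus_iota c T)) \<longleftrightarrow> b_monotone c T"
proof -
  have "c_plus_iota c T z + ereal (big_C c (u, prod.swap z)) \<le> c_plus_iota c T u + ereal (2 * c z)
          \<longleftrightarrow> (u \<in> mgraph T \<longrightarrow> 0 \<le> gap c z u)" if "z \<in> mgraph T" for z u
    using that by (auto simp: c_plus_iota_def iota_def big_C_swap)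
  then show ?thesis
    unfolding Delta_map_subdiff_iff b_monotone_iff_gap by blast
qed

lemma proper_fun_c_plus_iota:
  assumes "mgraph T \<noteq> {}"
  shows "proper_fun (c_plus_iota c T)"
proof -
  obtain z where "z \<in> mgraph T"
    using assms by blast
  then have "c_plus_iota c T z \<noteq> \<infinity>"
    by (simp add: c_plus_iota_def iota_def)
  moreover have "no_minf (c_plus_iota c T)"
    by (simp add: no_minf_def c_plus_iota_def iota_def)
  ultimately show ?thesis
    unfolding proper_fun_def by blast
qed

section \<open>Maximality\<close>

text \<open>Every subset of \<open>\<Delta>\<close> is the graph of some \<open>\<Delta>\<^sub>S\<close>, so quantifying over extensions inside
  \<open>\<Delta>\<close> amounts to quantifying over extensions of \<open>T\<close>.\<close>

lemma maximal_in_Delta: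
  "maximal_in P Delta (Delta_map T) \<longleftrightarrow> maximal_in (\<lambda>S. P (Delta_map S)) UNIV T"
proof -
  have inj: "inj (\<lambda>z :: 'a \<times> 'b. (z, prod.swap z))"
    by (auto intro: injI)
  have strict: "mgraph (Delta_map T) \<subset> mgraph (Delta_map S) \<longleftrightarrow> mgraph T \<subset> mgraph S" for S
    unfolding mgraph_Delta_map psubset_eq inj_image_subset_iff[OF inj] inj_image_eq_iff[OF inj] ..
  have sub: "mgraph (Delta_map S) \<subseteq> Delta" for S :: "'a \<Rightarrow> 'b set"
    by (auto simp: mgraph_Delta_map Delta_def)
  have onto: "\<exists>S. N = Delta_map S" if "mgraph N \<subseteq> Delta" for N :: "'a \<times> 'b \<Rightarrow> ('b \<times> 'a) set"
  proof
    show "N = Delta_map (\<lambda>x. {y. (y, x) \<in> N (x, y)})"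
      using that by (auto simp: fun_eq_iff Delta_map_def map_of_graph_def mgraph_def Delta_def)
  qed
  have "(\<forall>N. mgraph (Delta_map T) \<subset> mgraph N \<and> mgraph N \<subseteq> Delta \<longrightarrow> \<not> P N) \<longleftrightarrow>
          (\<forall>S. mgraph T \<subset> mgraph S \<longrightarrow> \<not> P (Delta_map S))"
    using strict sub onto by metis
  then show ?thesis
    by (simp add: maximal_in_def sub)
qed

text \<open>If \<open>z\<close> had nonnegative gap with all of \<open>G(T)\<close>, then \<open>G(T) \<union> {z}\<close> would still be
  monotone, the gap of \<open>z\<close> with itself being zero.\<close>

lemma maximal_b_monotone_negative_gap:
  assumes max: "maximal_b_monotone c T" and z: "z \<notin> mgraph T"
  obtains w where "w \<in> mgraph T" "gap c z w < 0"
proof (rule ccontr)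
  assume "\<not> thesis"
  then have nonneg: "0 \<le> gap c z w" if "w \<in> mgraph T" for w
    using that \<open>\<And>w. w \<in> mgraph T \<Longrightarrow> gap c z w < 0 \<Longrightarrow> thesis\<close> by fastforce
  define S where "S = map_of_graph (insert z (mgraph T))"
  have S: "mgraph S = insert z (mgraph T)"
    by (auto simp: S_def mgraph_def map_of_graph_def)
  have "b_monotone c T"
    using max by (simp add: maximal_b_monotone_def maximal_in_def)
  then have "b_monotone c S"
    unfolding b_monotone_iff_gap S using nonneg by (auto simp: gap_commute[where w = z])
  moreover have "mgraph T \<subset> mgraph S"
    using z S by blast
  ultimately show False
    using max by (auto simp: maximal_b_monotone_def maximal_in_def)
qed

section \<open>The Fitzpatrick function as least antiderivative\<close>

lemma Fitzpatrick_eq_SUP: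
  "Fitzpatrick c T u = (SUP z \<in> mgraph T. ereal (big_C c (u, prod.swap z) - c z))"
  by (cases u) (auto simp: Fitzpatrick_def big_C_def split_def intro!: SUP_cong)

lemma Fitzpatrick_ge_graph:
  assumes "z \<in> mgraph T"
  shows "ereal (big_C c (u, prod.swap z) - c z) \<le> Fitzpatrick c T u"
  unfolding Fitzpatrick_eq_SUP using assms by (rule SUP_upper)

lemma Fitzpatrick_eq_on_graph:
  assumes mono: "b_monotone c T" and z: "z \<in> mgraph T"
  shows "Fitzpatrick c T z = ereal (c z)"
proof (rule antisym)
  show "Fitzpatrick c T z \<le> ereal (c z)"
    unfolding Fitzpatrick_eq_SUP
    using mono z by (intro SUP_least) (simp add: big_C_swap b_monotone_iff_gap)
  show "ereal (c z) \<le> Fitzpatrick c T z"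
    using Fitzpatrick_ge_graph[OF z, of c z] by (simp add: big_C_swap)
qed

text \<open>The dual function that witnesses convexity is \<open>c + \<iota>\<close>, transposed: its infinite values
  remove the indices outside \<open>G(T)\<close> from the supremum over all of \<open>Y \<times> X\<close>.\<close>

lemma b_convex_Fitzpatrick:
  assumes mono: "b_monotone c T" and ne: "mgraph T \<noteq> {}"
  shows "b_convex (big_C c) (Fitzpatrick c T)"
proof -
  obtain z where z: "z \<in> mgraph T"
    using ne by blast
  have "Fitzpatrick c T u \<noteq> -\<infinity>" for u
    using Fitzpatrick_ge_graph[OF z, of c u] by auto
  moreover have "Fitzpatrick c T z \<noteq> \<infinity>"
    using Fitzpatrick_eq_on_graph[OF mono z] by simp
  ultimately have proper: "proper_fun (Fitzpatrick c T)"
    unfolding proper_fun_def no_minf_def by blast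
  define g where "g v = c_plus_iota c T (prod.swap v)" for v
  have "no_minf g"
    by (simp add: no_minf_def g_def c_plus_iota_def iota_def)
  moreover have "Fitzpatrick c T u = (SUP v. ereal (big_C c (u, v)) - g v)" for u
    unfolding Fitzpatrick_eq_SUP
  proof (rule antisym)
    show "(SUP z \<in> mgraph T. ereal (big_C c (u, prod.swap z) - c z))
            \<le> (SUP v. ereal (big_C c (u, v)) - g v)"
    proof (rule SUP_mono)
      fix w assume "w \<in> mgraph T"
      then have "ereal (big_C c (u, prod.swap w) - c w)
                   \<le> ereal (big_C c (u, prod.swap w)) - g (prod.swap w)"
        by (simp add: g_def c_plus_iota_def iota_def)
      then show "\<exists>v\<in>UNIV. ereal (big_C c (u, prod.swap w) - c w) \<le> ereal (big_C c (u, v)) - g v"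
        by blast
    qed
    show "(SUP v. ereal (big_C c (u, v)) - g v)
            \<le> (SUP z \<in> mgraph T. ereal (big_C c (u, prod.swap z) - c z))"
    proof (rule SUP_least)
      fix v
      show "ereal (big_C c (u, v)) - g v
              \<le> (SUP z \<in> mgraph T. ereal (big_C c (u, prod.swap z) - c z))"
      proof (cases "prod.swap v \<in> mgraph T")
        case True
        then show ?thesis
          by (intro SUP_upper2[OF True]) (simp add: g_def c_plus_iota_def iota_def)
      qed (simp add: g_def c_plus_iota_def iota_def)
    qed
  qed
  ultimately show ?thesis
    using proper unfolding b_convex_def by blast
qed

text \<open>With \<open>h = c\<close> on \<open>G(T)\<close>, the subgradient inequality at \<open>z\<close> for the subgradient
  \<open>z\<^sup>T\<close> reads \<open>c(z) + C(u, z\<^sup>T) \<le> h(u) + 2 c(z)\<close>, a bound from below by the affine-like function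
  that \<open>z\<close> contributes to the supremum \<open>F\<close>.\<close>

lemma Delta_map_subdiff_iff_Fitzpatrick_le:
  assumes eq: "\<forall>z \<in> mgraph T. h z = ereal (c z)"
  shows "mgraph (Delta_map T) \<subseteq> mgraph (subdiff (big_C c) h) \<longleftrightarrow>
           (\<forall>u. Fitzpatrick c T u \<le> h u)"
proof -
  have "h z + ereal (big_C c (u, prod.swap z)) \<le> h u + ereal (2 * c z) \<longleftrightarrow>
          ereal (big_C c (u, prod.swap z) - c z) \<le> h u" if "z \<in> mgraph T" for z u
    using eq that by (cases "h u") auto
  then show ?thesis
    unfolding Delta_map_subdiff_iff Fitzpatrick_eq_SUP SUP_le_iff by blast
qed

lemma antideriv_family_iff:
  "h \<in> antideriv_family (big_C c) c (mgraph T) (Delta_map T) \<longleftrightarrow>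
     b_convex (big_C c) h \<and> (\<forall>u. Fitzpatrick c T u \<le> h u) \<and> (\<forall>z \<in> mgraph T. h z = ereal (c z))"
  using Delta_map_subdiff_iff_Fitzpatrick_le[of T h c] by (auto simp: antideriv_family_def)

lemma minimal_antideriv_eq_Fitzpatrick:
  assumes mono: "b_monotone c T" and ne: "mgraph T \<noteq> {}"
  shows "minimal_antideriv (big_C c) c (mgraph T) (Delta_map T) = Fitzpatrick c T"
proof
  fix u
  have "Fitzpatrick c T \<in> antideriv_family (big_C c) c (mgraph T) (Delta_map T)"
    using b_convex_Fitzpatrick[OF mono ne] Fitzpatrick_eq_on_graph[OF mono]
    by (simp add: antideriv_family_iff)
  then show "minimal_antideriv (big_C c) c (mgraph T) (Delta_map T) u = Fitzpatrick c T u"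
    unfolding minimal_antideriv_def
    by (intro antisym INF_lower INF_greatest) (simp_all add: antideriv_family_iff del: split_paired_All)
qed

lemma maximal_b_monotone_le_Fitzpatrick:
  assumes max: "maximal_b_monotone c T"
  shows "ereal (c z) \<le> Fitzpatrick c T z"
proof (cases "z \<in> mgraph T")
  case True
  then show ?thesis
    using Fitzpatrick_ge_graph[OF True, of c z] by (simp add: big_C_swap)
next
  case False
  then obtain w where w: "w \<in> mgraph T" "gap c z w < 0"
    using maximal_b_monotone_negative_gap[OF max] by blast
  have "ereal (c z) \<le> ereal (big_C c (z, prod.swap w) - c w)"
    using w(2) by (simp add: big_C_swap gap_commute[of c w z])
  also have "\<dots> \<le> Fitzpatrick c T z"
    using w(1) by (rule Fitzpatrick_ge_graph)
  finally show ?thesis .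
qed

lemma antideriv_family_subset_Fitzpatrick_family:
  assumes "maximal_b_monotone c T"
  shows "antideriv_family (big_C c) c (mgraph T) (Delta_map T) \<subseteq> Fitzpatrick_family c T"
  using order_trans[OF maximal_b_monotone_le_Fitzpatrick[OF assms]]
  by (auto simp: antideriv_family_iff Fitzpatrick_family_def Gamma_conv_def)

section \<open>Characterizations of monotonicity and the Fitzpatrick function\<close>

theorem theorem6p3:
  fixes c :: "'x \<times> 'y \<Rightarrow> real"
    and T :: "'x \<Rightarrow> 'y set"
  assumes "mgraph T \<noteq> {}"
  shows
    "((b_monotone c T \<longleftrightarrow> b_monotone (big_C c) (Delta_map T)) \<and>
      (b_monotone (big_C c) (Delta_map T) \<longleftrightarrow>
         b_cyclically_monotone (big_C c) (Delta_map T)) \<and>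
      (b_cyclically_monotone (big_C c) (Delta_map T) \<longleftrightarrow>
         mgraph (Delta_map T) \<subseteq> mgraph (subdiff (big_C c) (c_plus_iota c T))) \<and>
      (mgraph (Delta_map T) \<subseteq> mgraph (subdiff (big_C c) (c_plus_iota c T)) \<longleftrightarrow>
         antiderivative (big_C c) (Delta_map T) (c_plus_iota c T)))
     \<and>
     ((maximal_b_monotone c T \<longleftrightarrow>
         maximal_in (b_monotone (big_C c)) Delta (Delta_map T)) \<and>
      (maximal_in (b_monotone (big_C c)) Delta (Delta_map T) \<longleftrightarrow>
         maximal_in (b_cyclically_monotone (big_C c)) Delta (Delta_map T)) \<and>
      (maximal_in (b_cyclically_monotone (big_C c)) Delta (Delta_map T) \<longleftrightarrow>
         maximal_in
           (\<lambda>S. mgraph (Delta_map S) \<subseteq> mgraph (subdiff (big_C c) (c_plus_iota c S))) UNIV T))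
     \<and>
     (b_monotone c T \<longrightarrow>
        minimal_antideriv (big_C c) c (mgraph T) (Delta_map T) = Fitzpatrick c T)
     \<and>
     (maximal_b_monotone c T \<longrightarrow>
        antideriv_family (big_C c) c (mgraph T) (Delta_map T) \<subseteq> Fitzpatrick_family c T)"
  using proper_fun_c_plus_iota[OF assms, of c] minimal_antideriv_eq_Fitzpatrick[OF _ assms, of c]
    antideriv_family_subset_Fitzpatrick_family[of c T]
  by (simp add: maximal_b_monotone_def maximal_in_Delta antiderivative_def
      b_monotone_Delta_map_iff cyclically_monotone_Delta_map_iff Delta_map_subdiff_c_plus_iota_iff)

end
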